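(* Let $n \geq 1$ and let $K$ be any field. Then a linear map $T\colon M_n(K) \to M_n(K)$ preserving $\leq_{\mathcal{J}}$ is either the zero map or a bijection.
   Context: $M_n(K)$ is the set of $n \times n$ matrices over $K$, viewed as a $K$-vector space and as a monoid under multiplication. Green's pre-order $\leq_{\mathcal{J}}$ on $M_n(K)$: $A \leq_{\mathcal{J}} B$ if $A = XBY$ for some $X, Y \in M_n(K)$ (over a field this means $\operatorname{rk}(A) \leq \operatorname{rk}(B)$). $T$ preserves $\leq_{\mathcal{J}}$ if $A \leq_{\mathcal{J}} B$ implies $T(A) \leq_{\mathcal{J}} T(B)$ for all $A,B \in M_n(K)$. *)

theory Defs
  imports "HOL-Analysis.Analysis"
begin

(* Entrywise scaling: "*s" on the type ('a^'n)^'n would take its scalars from 'a^'n, not from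
   the field 'a, and "scaleR" is only available over the reals. *)
definition matrix_scale :: "'a::field \<Rightarrow> 'a^'n^'n \<Rightarrow> 'a^'n^'n" where
  "matrix_scale c A = (\<chi> i j. c * A $ i $ j)"

lemma vector_space_matrix_scale:
  "vector_space (matrix_scale :: 'a::field \<Rightarrow> 'a^'n^'n \<Rightarrow> 'a^'n^'n)"
  by unfold_locales (simp_all add: matrix_scale_def vec_eq_iff algebra_simps)

definition green_J_le :: "'a::field^'n^'n \<Rightarrow> 'a^'n^'n \<Rightarrow> bool"  (infix "\<le>\<^sub>J" 50) where
  "A \<le>\<^sub>J B \<longleftrightarrow> (\<exists>X Y :: 'a^'n^'n. A = X ** B ** Y)"

definition preserves_J_le :: "('a::field^'n^'n \<Rightarrow> 'a^'n^'n) \<Rightarrow> bool" where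
  "preserves_J_le T \<longleftrightarrow> (\<forall>A B. A \<le>\<^sub>J B \<longrightarrow> T A \<le>\<^sub>J T B)"

end

theory Submission
  imports Defs
begin

text \<open>If \<open>T\<close> is not injective, it kills some nonzero \<open>A\<close>. Every matrix unit is \<open>\<le>\<^sub>J A\<close>, so
  \<open>T\<close> kills all matrix units, and these span. If \<open>T\<close> is injective, it is bijective because
  the space of matrices is finite-dimensional.\<close>

text \<open>A scalar multiple of a matrix unit. With the coefficient as an argument, every matrix is
  a plain sum of such matrices.\<close>

definition matrix_single :: "'n \<Rightarrow> 'n \<Rightarrow> 'a \<Rightarrow> 'a::field^'n^'n" where
  "matrix_single p q c = (\<chi> i j. if i = p \<and> j = q then c else 0)"

text \<open>The left factor moves row \<open>p\<close> to row \<open>i\<close>, the right factor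
  moves column \<open>q\<close> to column \<open>j\<close>, and all else is erased: one entry of
  \<open>A\<close> is isolated and relocated.\<close>

lemma matrix_single_mult_mult:
  "matrix_single i p c ** A ** matrix_single q j d = matrix_single i j (c * A $ p $ q * d)"
proof -
  have "matrix_single i p c ** A = (\<chi> k l. if k = i then c * A $ p $ l else 0)"
    by (simp add: matrix_single_def matrix_matrix_mult_def vec_eq_iff if_distrib[of "\<lambda>x. x * _"]
        cong: if_cong)
  then show ?thesis
    by (auto simp: matrix_single_def matrix_matrix_mult_def vec_eq_iff if_distrib[of "\<lambda>x. _ * x"]
        cong: if_cong)
qed

lemma matrix_single_le_J:
  assumes "A \<noteq> 0"
  shows "matrix_single i j c \<le>\<^sub>J A"
proof -
  obtain p q where "A $ p $ q \<noteq> 0"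
    using assms by (auto simp: vec_eq_iff)
  \<comment> \<open>Dividing by the nonzero entry makes the relocated entry exactly
    \<open>c\<close>.\<close>
  then have "matrix_single i j c = matrix_single i p (c / A $ p $ q) ** A ** matrix_single q j 1"
    by (simp add: matrix_single_mult_mult)
  then show ?thesis
    unfolding green_J_le_def by blast
qed

text \<open>Products with 0 vanish. Hence, if \<open>T\<close> preserves the pre-order and
  \<open>T A = 0\<close>, then \<open>T\<close> kills everything below \<open>A\<close>.\<close>

lemma le_J_zero_iff: "A \<le>\<^sub>J 0 \<longleftrightarrow> A = 0"
  by (simp add: green_J_le_def)

lemma matrix_eq_sum_matrix_single:
  "A = (\<Sum>p\<in>UNIV. \<Sum>q\<in>UNIV. matrix_single p q (A $ p $ q))"
proof -
  have "(\<Sum>p\<in>UNIV. \<Sum>q\<in>UNIV. if i = p \<and> j = q then A $ p $ q else 0) = A $ i $ j" for i j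
    by (simp add: if_if_eq_conj[symmetric] sum.If_cases)
  then show ?thesis
    by (simp add: matrix_single_def vec_eq_iff)
qed

lemma matrix_scale_single: "matrix_scale c (matrix_single p q d) = matrix_single p q (c * d)"
  by (simp add: matrix_scale_def matrix_single_def vec_eq_iff)

text \<open>The locale takes a finite basis as a parameter, hence the existential over
  \<open>B\<close>.\<close>

lemma finite_dimensional_matrix_scale:
  "\<exists>B. finite_dimensional_vector_space (matrix_scale :: 'a::field \<Rightarrow> 'a^'n^'n \<Rightarrow> 'a^'n^'n) B"
proof -
  interpret vector_space "matrix_scale :: 'a \<Rightarrow> 'a^'n^'n \<Rightarrow> 'a^'n^'n"
    by (rule vector_space_matrix_scale)
  define E :: "('a^'n^'n) set" where "E = (\<lambda>(p, q). matrix_single p q 1) ` UNIV"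
  have "matrix_single p q c \<in> span E" for p q :: 'n and c :: 'a
  proof -
    have "matrix_single p q 1 \<in> E"
      by (auto simp: E_def)
    from span_scale[OF span_base[OF this], of c] show ?thesis
      by (simp add: matrix_scale_single)
  qed
  then have "A \<in> span E" for A
    by (subst matrix_eq_sum_matrix_single) (intro span_sum)
  then have span_E: "span E = UNIV"
    by blast
  \<comment> \<open>Thinning the finite spanning set \<open>E\<close> to a maximal independent
    subset yields a basis without a direct check that the matrix units are independent.\<close>
  obtain B where B: "B \<subseteq> E" "independent B" "E \<subseteq> span B"
    using maximal_independent_subset[of E] by blast
  have "span B = UNIV"
    using span_minimal[OF B(3) subspace_span] span_E by blast
  moreover have "finite B"
    using B(1) by (rule finite_subset) (simp add: E_def)
  ultimately show ?thesis
    using B(2) by (intro exI[of _ B] finite_dimensional_vector_space.intro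
        finite_dimensional_vector_space_axioms.intro vector_space_matrix_scale)
qed

theorem corollary5p4:
  fixes T :: "'a::field^'n^'n \<Rightarrow> 'a^'n^'n"
  assumes "Vector_Spaces.linear matrix_scale matrix_scale T"
    and "preserves_J_le T"
  shows "T = (\<lambda>A. 0) \<or> bij T"
proof -
  interpret T: Vector_Spaces.linear matrix_scale matrix_scale T
    by (rule assms(1))
  show ?thesis
  proof (cases "inj T")
    case True
    obtain B where B: "finite_dimensional_vector_space
        (matrix_scale :: 'a \<Rightarrow> 'a^'n^'n \<Rightarrow> 'a^'n^'n) B"
      using finite_dimensional_matrix_scale by blast
    have "surj T"
      using finite_dimensional_vector_space.linear_inj_imp_surj[OF B assms(1) True] .
    with True show ?thesis
      by (simp add: bij_def)
  next
    case False
    then obtain A where A: "A \<noteq> 0" "T A = 0"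
      using T.inj_iff_eq_0 by blast
    have "T (matrix_single p q c) \<le>\<^sub>J T A" for p q c
      using assms(2) matrix_single_le_J[OF A(1)] by (simp add: preserves_J_le_def)
    then have "T (matrix_single p q c) = 0" for p q c
      by (simp add: A(2) le_J_zero_iff)
    \<comment> \<open>The entries of \<open>C\<close> sit inside the summands, which
      \<open>T\<close> kills for every coefficient, so additivity finishes.\<close>
    then have "T C = 0" for C
      by (subst matrix_eq_sum_matrix_single) (simp add: T.sum)
    then show ?thesis
      by blast
  qed
qed

end
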